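(* Let $P=(p_1,\ldots,p_n)$ be a labeled polygon in $\mathbb{RP}^2$ in the domain of Glick's operator $L_P$, and choose arbitrary nonzero homogeneous lifts $\widetilde p_i\in\mathbb{R}^3$. Put $[ijk]=\det(\widetilde p_i,\widetilde p_j,\widetilde p_k)$ and, with indices modulo $n$, $$c_{ij}=\frac{[i-1,j,i+1]}{[i-1,i,i+1]}.$$ Define $$\widehat L_P=L_P-\frac{2n}3I,\qquad\mathcal S_n(P)=\frac12\operatorname{tr}(\widehat L_P^2),\qquad\mathcal R_n(P)=\det(\widehat L_P).$$ Then $\mathcal S_n$ and $\mathcal R_n$ are projective invariants and $$\chi_{L_P}(t)=\left(t-\frac{2n}3\right)^3-\mathcal S_n(P)\left(t-\frac{2n}3\right)-\mathcal R_n(P).$$ Moreover, $$\mathcal S_n(P)=\frac12\left(\sum_{i,j=1}^nc_{ij}c_{ji}-\frac{n^2}3\right)$$ and $$\mathcal R_n(P)=-\frac{2n^3}{27}+\frac n3\sum_{i,j=1}^nc_{ij}c_{ji}-\frac13\sum_{i,j,k=1}^nc_{ij}c_{jk}c_{ki}.$$ In particular, the spectrum of $L_P$ is completely determined by the pair $(\mathcal S_n(P),\mathcal R_n(P))$.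
   Context: Glick's operator: for a labeled projective $n$-gon $P=(p_1,\dots,p_n)$ (indices modulo $n$) such that every consecutive triple $p_{i-1},p_i,p_{i+1}$ is noncollinear (the "domain of Glick's operator"), with nonzero homogeneous lifts $\widetilde p_i\in\mathbb{R}^3$, $$L_P(v)=nv-\sum_{j=1}^n\frac{\det(\widetilde p_{j-1},v,\widetilde p_{j+1})}{\det(\widetilde p_{j-1},\widetilde p_j,\widetilde p_{j+1})}\,\widetilde p_j ,\qquad v\in\mathbb{R}^3,$$ a linear operator on $\mathbb{R}^3$ independent of the lifts. $\chi_A(t)=\det(tI-A)$. Projective invariant means unchanged when $P$ is replaced by $\psi(P)$ for a projective transformation $\psi$ of $\mathbb{RP}^2$. *)

theory Defs
  imports "HOL-Analysis.Analysis" "HOL-Computational_Algebra.Polynomial"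
begin

section \<open>The real projective plane\<close>

text \<open>Points of the real projective plane are the lines through the origin of \<open>\<real>\<^sup>3\<close>.\<close>

typedef rp2 = "{S :: (real^3) set. subspace S \<and> dim S = 1}"
  morphisms line_of Abs_rp2
  by (rule exI[of _ "span {axis 1 1}"]) (simp add: dim_span)

definition is_lift :: "rp2 \<Rightarrow> real^3 \<Rightarrow> bool" where
  "is_lift q v \<longleftrightarrow> v \<noteq> 0 \<and> v \<in> line_of q"

text \<open>A projective line is (the set of points lying on) a plane through the origin.\<close>

definition collinear_rp2 :: "rp2 \<Rightarrow> rp2 \<Rightarrow> rp2 \<Rightarrow> bool" where
  "collinear_rp2 a b c \<longleftrightarrow>
     (\<exists>W. subspace W \<and> dim W = 2 \<and> line_of a \<subseteq> W \<and> line_of b \<subseteq> W \<and> line_of c \<subseteq> W)"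

definition projective_transformation :: "(rp2 \<Rightarrow> rp2) \<Rightarrow> bool" where
  "projective_transformation \<psi> \<longleftrightarrow>
     (\<exists>A :: real^3^3. invertible A \<and> (\<forall>q. line_of (\<psi> q) = (\<lambda>v. A *v v) ` line_of q))"


section \<open>Labeled polygons and Glick's operator\<close>

text \<open>Indices modulo \<open>n\<close> are rendered by \<open>n\<close>-periodic families indexed by the integers.\<close>

definition ngon :: "nat \<Rightarrow> (int \<Rightarrow> rp2) \<Rightarrow> bool" where
  "ngon n P \<longleftrightarrow> 0 < n \<and> (\<forall>i. P (i + int n) = P i)"

text \<open>For an \<open>n\<close>-gon this condition forces \<open>n \<ge> 3\<close>.\<close>

definition glick_domain :: "(int \<Rightarrow> rp2) \<Rightarrow> bool" where
  "glick_domain P \<longleftrightarrow> (\<forall>i. \<not> collinear_rp2 (P (i - 1)) (P i) (P (i + 1)))"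

definition lifts :: "nat \<Rightarrow> (int \<Rightarrow> rp2) \<Rightarrow> (int \<Rightarrow> real^3) \<Rightarrow> bool" where
  "lifts n P p \<longleftrightarrow> (\<forall>i. is_lift (P i) (p i)) \<and> (\<forall>i. p (i + int n) = p i)"

definition det3 :: "real^3 \<Rightarrow> real^3 \<Rightarrow> real^3 \<Rightarrow> real" where
  "det3 u v w = det (vector [u, v, w] :: real^3^3)"

definition glick_of_lifts :: "nat \<Rightarrow> (int \<Rightarrow> real^3) \<Rightarrow> real^3 \<Rightarrow> real^3" where
  "glick_of_lifts n p v = real n *\<^sub>R v -
     (\<Sum>j = 1..int n. (det3 (p (j - 1)) v (p (j + 1)) / det3 (p (j - 1)) (p j) (p (j + 1))) *\<^sub>R p j)"

text \<open>The choice of lifts is immaterial, see \<open>glick_of_lifts_eq\<close> below.\<close>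

definition glick :: "nat \<Rightarrow> (int \<Rightarrow> rp2) \<Rightarrow> real^3 \<Rightarrow> real^3" where
  "glick n P = glick_of_lifts n (\<lambda>i. SOME v. is_lift (P i) v)"

definition coef :: "(int \<Rightarrow> real^3) \<Rightarrow> int \<Rightarrow> int \<Rightarrow> real" where
  "coef p i j = det3 (p (i - 1)) (p j) (p (i + 1)) / det3 (p (i - 1)) (p i) (p (i + 1))"

text \<open>Note that \<open>mat c\<close> is \<open>c\<close> times the identity matrix.\<close>

definition glick_hat :: "nat \<Rightarrow> (int \<Rightarrow> rp2) \<Rightarrow> real^3^3" where
  "glick_hat n P = matrix (glick n P) - mat (2 * real n / 3)"

definition S_inv :: "nat \<Rightarrow> (int \<Rightarrow> rp2) \<Rightarrow> real" where
  "S_inv n P = 1/2 * trace (glick_hat n P ** glick_hat n P)"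

definition R_inv :: "nat \<Rightarrow> (int \<Rightarrow> rp2) \<Rightarrow> real" where
  "R_inv n P = det (glick_hat n P)"

definition projective_invariant :: "nat \<Rightarrow> ((int \<Rightarrow> rp2) \<Rightarrow> real) \<Rightarrow> bool" where
  "projective_invariant n f \<longleftrightarrow>
     (\<forall>P \<psi>. ngon n P \<and> glick_domain P \<and> projective_transformation \<psi> \<longrightarrow> f (\<psi> \<circ> P) = f P)"


section \<open>Characteristic polynomial and spectrum\<close>

definition charpoly :: "'a::comm_ring_1^'n^'n \<Rightarrow> 'a poly" where
  "charpoly A = det (mat [:0, 1:] - map_matrix (\<lambda>a. [:a:]) A)"

text \<open>The spectrum of a real matrix consists of its complex eigenvalues.\<close>

definition complexify :: "real^'n^'n \<Rightarrow> complex^'n^'n" where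
  "complexify A = map_matrix complex_of_real A"

definition spectrum :: "real^'n^'n \<Rightarrow> complex set" where
  "spectrum A = {z. \<exists>v. v \<noteq> 0 \<and> complexify A *v v = z *s v}"

definition alg_mult :: "real^'n^'n \<Rightarrow> complex \<Rightarrow> nat" where
  "alg_mult A z = order z (charpoly (complexify A))"


section \<open>Well-definedness\<close>

lemma poly_charpoly: "poly (charpoly A) t = det (mat t - A)"
proof -
  have "poly ((mat [:0, 1:] - map_matrix (\<lambda>a. [:a:]) A) $ i $ j) t = (mat t - A) $ i $ j" for i j
    by (simp add: mat_def)
  then show ?thesis
    unfolding charpoly_def det_def by (simp add: poly_sum poly_prod)
qed

lemma det3_expand:
  "det3 u v w = u$1 * v$2 * w$3 + u$2 * v$3 * w$1 + u$3 * v$1 * w$2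
     - u$1 * v$3 * w$2 - u$2 * v$1 * w$3 - u$3 * v$2 * w$1"
  by (simp add: det3_def det_3)

lemma is_lift_exists: "\<exists>v. is_lift q v"
proof -
  have "dim (line_of q) = 1" using line_of[of q] by simp
  then have "\<not> line_of q \<subseteq> {0}" by (metis dim_eq_0 zero_neq_one)
  then show ?thesis unfolding is_lift_def by blast
qed

lemma is_lift_span: assumes "is_lift q v" shows "line_of q = span {v}"
proof -
  have s: "subspace (line_of q)" "dim (line_of q) = 1" using line_of[of q] by simp_all
  have sub: "span {v} \<subseteq> line_of q"
    using assms s(1) unfolding is_lift_def by (simp add: span_minimal)
  have "dim (span {v}) = 1" using assms unfolding is_lift_def by (simp add: dim_span)
  then show ?thesis using subspace_dim_equal[of "span {v}" "line_of q"] sub s by auto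
qed

lemma is_lift_scale:
  assumes "is_lift q v" "is_lift q w"
  obtains a where "a \<noteq> 0" "w = a *\<^sub>R v"
proof -
  have "w \<in> span {v}" using assms is_lift_span unfolding is_lift_def by blast
  then obtain a where "w = a *\<^sub>R v" by (auto simp: span_singleton)
  moreover have "w \<noteq> 0" using assms unfolding is_lift_def by simp
  ultimately show thesis using that by auto
qed

lemma glick_of_lifts_eq:
  assumes "\<And>i. is_lift (P i) (p i)"
  shows "glick_of_lifts n p = glick n P"
proof -
  define q where "q = (\<lambda>i. SOME v. is_lift (P i) v)"
  have q: "is_lift (P i) (q i)" for i
    unfolding q_def by (rule someI_ex) (rule is_lift_exists)
  have "\<exists>a. a \<noteq> 0 \<and> p i = a *\<^sub>R q i" for i
    using is_lift_scale[OF q assms] by metis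
  then obtain a where a: "\<And>i. a i \<noteq> 0" "\<And>i. p i = a i *\<^sub>R q i" by metis
  have sc: "det3 (x *\<^sub>R u) v w = x * det3 u v w" "det3 u (x *\<^sub>R v) w = x * det3 u v w"
      "det3 u v (x *\<^sub>R w) = x * det3 u v w" for x u v w
    by (simp_all add: det3_expand algebra_simps)
  have "(det3 (p (j - 1)) v (p (j + 1)) / det3 (p (j - 1)) (p j) (p (j + 1))) *\<^sub>R p j =
        (det3 (q (j - 1)) v (q (j + 1)) / det3 (q (j - 1)) (q j) (q (j + 1))) *\<^sub>R q j" for j v
    using a(1)[of j] a(1)[of "j-1"] a(1)[of "j+1"] by (simp add: a(2) sc)
  then show ?thesis
    unfolding glick_def q_def[symmetric] glick_of_lifts_def by auto
qed

lemma linear_glick: "linear (glick n P)"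
proof -
  have *: "det3 u (x + y) w = det3 u x w + det3 u y w" "det3 u (r *\<^sub>R x) w = r * det3 u x w"
    for u x y w r
    by (simp_all add: det3_expand algebra_simps)
  show ?thesis
    unfolding glick_def glick_of_lifts_def
    by (rule linearI)
       (simp_all add: * algebra_simps add_divide_distrib sum.distrib scaleR_sum_right)
qed

lemma collinear_if_det3_0:
  assumes "is_lift a u" "is_lift b v" "is_lift c w" "det3 u v w = 0"
  shows "collinear_rp2 a b c"
proof -
  define M where "M = (vector [u, v, w] :: real^3^3)"
  have "rows M = (\<lambda>i. M $ i) ` UNIV"
    unfolding rows_def row_def by (auto simp: vec_lambda_eta)
  then have r: "rows M = {u, v, w}"
    by (simp add: UNIV_3 M_def insert_commute)
  have "rank M < 3"
    using assms(4) rank_bound[of M] det_eq_0_rank[of M] unfolding det3_def M_def[symmetric] by simp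
  then have "dim {u, v, w} < DIM(real^3)"
    by (simp add: row_rank_def r)
  then obtain x where x: "x \<noteq> 0" "\<And>y. y \<in> span {u, v, w} \<Longrightarrow> orthogonal x y"
    using orthogonal_to_subspace_exists by metis
  define W where "W = {y. x \<bullet> y = 0}"
  have W: "subspace W" "dim W = 2"
    unfolding W_def using x(1) by (simp_all add: subspace_hyperplane dim_hyperplane)
  have "u \<in> W" "v \<in> W" "w \<in> W"
    using x(2) unfolding W_def orthogonal_def by (auto intro: span_base)
  then have "span {u} \<subseteq> W" "span {v} \<subseteq> W" "span {w} \<subseteq> W"
    using W(1) by (simp_all add: span_minimal)
  then show ?thesis
    unfolding collinear_rp2_def
    using W assms(1-3) is_lift_span by metis
qed

lemma glick_domain_projective:
  assumes "projective_transformation \<psi>" "glick_domain P"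
  shows "glick_domain (\<psi> \<circ> P)"
proof -
  obtain A :: "real^3^3" where A: "invertible A" "\<And>q. line_of (\<psi> q) = (\<lambda>v. A *v v) ` line_of q"
    using assms(1) unfolding projective_transformation_def by blast
  obtain B where B: "B ** A = mat 1" "A ** B = mat 1" using A(1) unfolding invertible_def by blast
  have BA: "B *v (A *v v) = v" for v by (simp add: matrix_vector_mul_assoc B)
  have AB: "A *v (B *v v) = v" for v by (simp add: matrix_vector_mul_assoc B)
  have "collinear_rp2 a b c" if col: "collinear_rp2 (\<psi> a) (\<psi> b) (\<psi> c)" for a b c
  proof -
    obtain W where W: "subspace W" "dim W = 2"
      "line_of (\<psi> a) \<subseteq> W" "line_of (\<psi> b) \<subseteq> W" "line_of (\<psi> c) \<subseteq> W"
      using col unfolding collinear_rp2_def by blast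
    let ?V = "(\<lambda>v. B *v v) ` W"
    have inj: "inj (\<lambda>v. B *v v)"
    proof (rule injI)
      fix x y assume "B *v x = B *v y"
      then have "A *v (B *v x) = A *v (B *v y)" by simp
      then show "x = y" unfolding AB .
    qed
    have "subspace ?V"
      by (rule linear_subspace_image[OF matrix_vector_mul_linear W(1)])
    moreover have "dim ?V = 2"
      using dim_image_eq[OF matrix_vector_mul_linear, of B W] inj_on_subset[OF inj subset_UNIV] W(2) by auto
    moreover have "line_of q \<subseteq> ?V" if "line_of (\<psi> q) \<subseteq> W" for q
    proof
      fix v assume "v \<in> line_of q"
      then have "A *v v \<in> W" using that unfolding A(2) by blast
      then have "B *v (A *v v) \<in> ?V" by (rule imageI)
      then show "v \<in> ?V" unfolding BA .
    qed
    ultimately show ?thesis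
      unfolding collinear_rp2_def using W(3-5) by (intro exI[of _ ?V]) blast
  qed
  then show ?thesis using assms(2) unfolding glick_domain_def by auto
qed

end

theory Submission
  imports Defs
begin

text \<open>
  Write \<open>L\<^sub>P = n I - M\<close>, where \<open>M\<close> is the sum of the rank-one operators
  \<open>v \<mapsto> \<phi>\<^sub>j(v) p\<^sub>j\<close> with \<open>\<phi>\<^sub>i(p\<^sub>j) = c\<^sub>i\<^sub>j\<close>. The traces of \<open>M\<close>, \<open>M\<^sup>2\<close>, \<open>M\<^sup>3\<close> are the cyclic
  sums of the \<open>c\<^sub>i\<^sub>j\<close>, and \<open>c\<^sub>i\<^sub>i = 1\<close> makes \<open>n I / 3 - M\<close> traceless.
  For a traceless \<open>3 \<times> 3\<close> matrix \<open>H\<close> the characteristic polynomial is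
  \<open>t\<^sup>3 - tr(H\<^sup>2) t / 2 - det H\<close>, and \<open>det H = tr(H\<^sup>3) / 3\<close>. Invariance follows since the \<open>c\<^sub>i\<^sub>j\<close> do
  not change when all lifts are multiplied by the same invertible matrix.
\<close>

section \<open>Traces and determinants\<close>

lemma trace_3: "trace (A :: 'a::comm_ring_1^3^3) = A$1$1 + A$2$2 + A$3$3"
  by (simp add: trace_def sum_3)

lemma trace_scaleR: "trace (c *\<^sub>R A :: real^'n^'n) = c * trace A"
  by (simp add: trace_def sum_distrib_left)

lemma trace_mat: "trace (mat c :: 'a::comm_ring_1^'n^'n) = of_nat CARD('n) * c"
  by (simp add: trace_def mat_def)

lemma mat_eq_scaleR: "(mat c :: real^'n^'n) = c *\<^sub>R mat 1"
  by (simp add: mat_def vec_eq_iff)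

text \<open>Here the second elementary symmetric function of the eigenvalues is
  \<open>(tr(H)^2 - tr(H^2)) / 2\<close>, and the first term vanishes. The entries range over a
  general field because the identity is needed both over the reals and over the complex
  numbers.\<close>

lemma charpoly_traceless_3:
  fixes H :: "'a::field_char_0^3^3"
  assumes "trace H = 0"
  shows "det (mat t - H) = t ^ 3 - trace (H ** H) / 2 * t - det H"
proof -
  \<comment> \<open>Eliminating one diagonal entry leaves a polynomial identity in \<open>t\<close>
    and the other eight entries.\<close>
  have 33: "H$3$3 = - H$1$1 - H$2$2"
    using assms by (simp add: trace_3 algebra_simps add_eq_0_iff)
  show ?thesis
    unfolding det_3 trace_3 by (simp add: matrix_matrix_mult_def sum_3 mat_def 33)
      (simp add: field_simps power3_eq_cube)
qed

text \<open>Newton's identity for the third power sum, in which the terms containing the trace drop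
  out.\<close>

lemma det_traceless_3:
  fixes H :: "'a::field_char_0^3^3"
  assumes "trace H = 0"
  shows "det H = trace (H ** H ** H) / 3"
proof -
  have 33: "H$3$3 = - H$1$1 - H$2$2"
    using assms by (simp add: trace_3 algebra_simps add_eq_0_iff)
  show ?thesis
    unfolding det_3 trace_3 by (simp add: matrix_matrix_mult_def sum_3 33)
      (simp add: field_simps)
qed

section \<open>Sums of rank-one matrices and the traces of their powers\<close>

definition sum_rank_one :: "'i set \<Rightarrow> ('i \<Rightarrow> real^'n) \<Rightarrow> ('i \<Rightarrow> real^'n) \<Rightarrow> real^'n^'n" where
  "sum_rank_one I p f = (\<chi> a b. \<Sum>j\<in>I. p j $ a * f j $ b)"

lemma sum_rank_one_mult: "sum_rank_one I p f *v v = (\<Sum>j\<in>I. (f j \<bullet> v) *\<^sub>R p j)"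
proof -
  have "(\<Sum>b\<in>UNIV. (\<Sum>j\<in>I. p j $ a * f j $ b) * v $ b) = (\<Sum>j\<in>I. (f j \<bullet> v) * p j $ a)" for a
    unfolding inner_vec_def sum_distrib_right sum_distrib_left
    by (subst sum.swap) (simp add: mult_ac)
  then show ?thesis
    by (simp add: sum_rank_one_def matrix_vector_mult_def vec_eq_iff)
qed

text \<open>Cyclicity of the trace turns each summand \<open>tr(N p f^T)\<close> into the number
  \<open>f^T N p\<close>. Taking the identity, the sum itself and its square for \<open>N\<close>
  gives the three traces below.\<close>

lemma trace_mult_sum_rank_one:
  "trace (N ** sum_rank_one I p f) = (\<Sum>j\<in>I. f j \<bullet> (N *v p j))"
proof -
  have "trace (N ** sum_rank_one I p f)
      = (\<Sum>a\<in>UNIV. \<Sum>b\<in>UNIV. \<Sum>j\<in>I. f j $ a * (N $ a $ b * p j $ b))"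
    by (simp add: trace_def matrix_matrix_mult_def sum_rank_one_def sum_distrib_left mult_ac)
  also have "\<dots> = (\<Sum>a\<in>UNIV. \<Sum>j\<in>I. \<Sum>b\<in>UNIV. f j $ a * (N $ a $ b * p j $ b))"
    by (intro sum.cong refl sum.swap)
  also have "\<dots> = (\<Sum>j\<in>I. \<Sum>a\<in>UNIV. \<Sum>b\<in>UNIV. f j $ a * (N $ a $ b * p j $ b))"
    by (rule sum.swap)
  finally show ?thesis
    by (simp add: inner_vec_def matrix_vector_mult_def sum_distrib_left)
qed

lemma trace_sum_rank_one: "trace (sum_rank_one I p f) = (\<Sum>i\<in>I. f i \<bullet> p i)"
  using trace_mult_sum_rank_one[of "mat 1" I p f] by simp

lemma trace_sum_rank_one_2:
  "trace (sum_rank_one I p f ** sum_rank_one I p f)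
     = (\<Sum>i\<in>I. \<Sum>j\<in>I. (f i \<bullet> p j) * (f j \<bullet> p i))"
  unfolding trace_mult_sum_rank_one sum_rank_one_mult inner_sum_right inner_scaleR_right
  by (simp add: mult.commute)

lemma trace_sum_rank_one_3:
  "trace (sum_rank_one I p f ** sum_rank_one I p f ** sum_rank_one I p f)
     = (\<Sum>i\<in>I. \<Sum>j\<in>I. \<Sum>k\<in>I. (f i \<bullet> p j) * (f j \<bullet> p k) * (f k \<bullet> p i))"
  unfolding trace_mult_sum_rank_one matrix_vector_mul_assoc[symmetric] sum_rank_one_mult
    inner_sum_right inner_scaleR_right sum_distrib_right
  by (simp add: mult_ac)

section \<open>The coefficients\<close>

lemma det3_nonzero:
  assumes "glick_domain P" "lifts n P p"
  shows "det3 (p (i - 1)) (p i) (p (i + 1)) \<noteq> 0"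
  using assms collinear_if_det3_0 unfolding glick_domain_def lifts_def by blast

text \<open>The functional \<phi>_j is stored as the vector that represents it under the inner
  product; its components are the values on the standard basis.\<close>

definition glick_form :: "(int \<Rightarrow> real^3) \<Rightarrow> int \<Rightarrow> real^3" where
  "glick_form p j = (\<chi> b. det3 (p (j - 1)) (axis b 1) (p (j + 1))
     / det3 (p (j - 1)) (p j) (p (j + 1)))"

lemma inner_glick_form:
  "glick_form p j \<bullet> v = det3 (p (j - 1)) v (p (j + 1)) / det3 (p (j - 1)) (p j) (p (j + 1))"
proof -
  have "det3 u v w = (\<Sum>b\<in>UNIV. det3 u (axis b 1) w * v $ b)" for u w
    by (simp add: sum_3 det3_expand axis_def algebra_simps)
  then show ?thesis
    by (simp add: glick_form_def inner_vec_def sum_divide_distrib)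
qed

lemma inner_glick_form_coef: "glick_form p i \<bullet> p j = coef p i j"
  by (simp add: inner_glick_form coef_def)

lemma det3_matrix_mult: "det3 (A *v u) (A *v v) (A *v w) = det A * det3 u v w"
proof -
  \<comment> \<open>The three vectors are the rows of the matrix in \<open>det3\<close>, so
    \<open>A\<close> acts on it from the right through its transpose.\<close>
  have "vector [A *v u, A *v v, A *v w] = (vector [u, v, w] :: real^3^3) ** transpose A"
    by (simp add: vec_eq_iff forall_3 matrix_matrix_mult_def matrix_vector_mult_def
        transpose_def mult.commute)
  then show ?thesis
    by (simp add: det3_def det_mul)
qed

lemma coef_matrix_mult:
  assumes "invertible A"
  shows "coef (\<lambda>i. A *v p i) = coef p"
  using assms by (simp add: fun_eq_iff coef_def det3_matrix_mult invertible_det_nz)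

lemma lifts_projective:
  assumes "lifts n P p" "invertible A" "\<And>q. line_of (\<psi> q) = (\<lambda>v. A *v v) ` line_of q"
  shows "lifts n (\<psi> \<circ> P) (\<lambda>i. A *v p i)"
proof -
  have "A *v v \<noteq> 0" if "v \<noteq> 0" for v
    using that assms(2) matrix_left_invertible_ker[of A] unfolding invertible_def by blast
  then show ?thesis
    using assms(1,3) by (auto simp: lifts_def is_lift_def)
qed

lemma lifts_exist:
  assumes "ngon n P"
  obtains p where "lifts n P p"
proof
  \<comment> \<open>The chosen lift depends only on the point \<open>P i\<close>, hence inherits the
    periodicity of \<open>P\<close>.\<close>
  show "lifts n P (\<lambda>i. SOME v. is_lift (P i) v)"
    using assms someI_ex[OF is_lift_exists] by (simp add: lifts_def ngon_def)
qed

section \<open>The matrix of Glick's operator and its traceless part\<close>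

lemma glick_matrix:
  assumes "lifts n P p"
  shows "matrix (glick n P) = mat (real n) - sum_rank_one {1..int n} p (glick_form p)"
proof -
  have eq: "glick n P = glick_of_lifts n p"
    by (rule glick_of_lifts_eq[symmetric]) (use assms in \<open>simp add: lifts_def\<close>)
  have "mat (real n) *v v = real n *\<^sub>R v" for v :: "real^3"
    by (simp add: mat_eq_scaleR[of "real n"] flip: scaleR_matrix_vector_assoc)
  then have "glick n P = (\<lambda>v. (mat (real n) - sum_rank_one {1..int n} p (glick_form p)) *v v)"
    by (simp add: fun_eq_iff eq glick_of_lifts_def matrix_vector_mult_diff_rdistrib
        sum_rank_one_mult inner_glick_form)
  then show ?thesis
    by simp
qed

lemma glick_hat_eq:
  assumes "lifts n P p"
  shows "glick_hat n P = mat (real n / 3) - sum_rank_one {1..int n} p (glick_form p)"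
  by (simp add: glick_hat_def glick_matrix[OF assms] vec_eq_iff mat_def)

text \<open>Every diagonal coefficient is a quotient of equal brackets, which are nonzero on the
  domain of the operator, so each of the \<open>n\<close> summands is 1.\<close>

lemma trace_sum_rank_one_glick:
  assumes "glick_domain P" "lifts n P p"
  shows "trace (sum_rank_one {1..int n} p (glick_form p)) = real n"
  using det3_nonzero[OF assms]
  by (simp add: trace_sum_rank_one inner_glick_form_coef coef_def)

lemma trace_glick_hat:
  assumes "glick_domain P" "lifts n P p"
  shows "trace (glick_hat n P) = 0"
  by (simp add: glick_hat_eq[OF assms(2)] trace_sub trace_mat trace_sum_rank_one_glick[OF assms])

text \<open>Binomial expansions, valid since a scalar matrix commutes with \<open>M\<close>. Both
  are checked on vectors, where products become iterated actions.\<close>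

lemma shifted_square_cube:
  fixes M :: "real^'n^'n" and c :: real
  defines "H \<equiv> mat c - M"
  shows "H ** H = c\<^sup>2 *\<^sub>R mat 1 - (2 * c) *\<^sub>R M + M ** M"
    and "H ** H ** H = c ^ 3 *\<^sub>R mat 1 - (3 * c\<^sup>2) *\<^sub>R M + (3 * c) *\<^sub>R (M ** M) - M ** M ** M"
proof -
  have H: "H *v x = c *\<^sub>R x - M *v x" for x
    by (simp add: H_def matrix_vector_mult_diff_rdistrib mat_eq_scaleR[of c]
        flip: scaleR_matrix_vector_assoc)
  show "H ** H = c\<^sup>2 *\<^sub>R mat 1 - (2 * c) *\<^sub>R M + M ** M"
    by (simp add: matrix_eq H matrix_vector_mult_diff_rdistrib matrix_vector_mult_add_rdistrib
        matrix_vector_mult_diff_distrib matrix_vector_mult_scaleR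
        flip: matrix_vector_mul_assoc scaleR_matrix_vector_assoc)
       (simp add: vec_eq_iff algebra_simps power2_eq_square)
  show "H ** H ** H = c ^ 3 *\<^sub>R mat 1 - (3 * c\<^sup>2) *\<^sub>R M + (3 * c) *\<^sub>R (M ** M) - M ** M ** M"
    by (simp add: matrix_eq H matrix_vector_mult_diff_rdistrib matrix_vector_mult_add_rdistrib
        matrix_vector_mult_diff_distrib matrix_vector_mult_scaleR
        flip: matrix_vector_mul_assoc scaleR_matrix_vector_assoc)
       (simp add: vec_eq_iff algebra_simps power2_eq_square power3_eq_cube)
qed

section \<open>Formulas for the two invariants and their projective invariance\<close>

lemma S_inv_coef:
  assumes "glick_domain P" "lifts n P p"
  shows "S_inv n P =
    1/2 * ((\<Sum>i = 1..int n. \<Sum>j = 1..int n. coef p i j * coef p j i) - real n ^ 2 / 3)"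
  \<comment> \<open>With \<open>c = n/3\<close> and \<open>tr M = n\<close>, the terms other than
    \<open>tr(M^2)\<close> add up to \<open>3 c^2 - 2 c n = - n^2 / 3\<close>.\<close>
  unfolding S_inv_def glick_hat_eq[OF assms(2)] shifted_square_cube(1) trace_sub trace_add
    trace_scaleR trace_sum_rank_one_glick[OF assms] trace_mat trace_sum_rank_one_2
    inner_glick_form_coef
  by (simp add: field_simps power2_eq_square)

lemma R_inv_coef:
  assumes "glick_domain P" "lifts n P p"
  shows "R_inv n P = - 2 * real n ^ 3 / 27
    + real n / 3 * (\<Sum>i = 1..int n. \<Sum>j = 1..int n. coef p i j * coef p j i)
    - 1/3 * (\<Sum>i = 1..int n. \<Sum>j = 1..int n. \<Sum>k = 1..int n.
               coef p i j * coef p j k * coef p k i)"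
proof -
  let ?M = "sum_rank_one {1..int n} p (glick_form p)"
  have "R_inv n P = trace (glick_hat n P ** glick_hat n P ** glick_hat n P) / 3"
    unfolding R_inv_def by (rule det_traceless_3[OF trace_glick_hat[OF assms]])
  \<comment> \<open>Again \<open>c = n/3\<close>: the scalar and linear terms of the cube have trace
    \<open>3 c^3 - 3 c^2 n = - 2 n^3 / 9\<close>, and the factor of \<open>tr(M^2)\<close> is
    \<open>3 c = n\<close>.\<close>
  also have "\<dots> = - 2 * real n ^ 3 / 27 + real n / 3 * trace (?M ** ?M)
      - 1/3 * trace (?M ** ?M ** ?M)"
    unfolding glick_hat_eq[OF assms(2)] shifted_square_cube(2) trace_sub trace_add trace_scaleR
      trace_sum_rank_one_glick[OF assms] trace_mat
    by (simp add: field_simps power2_eq_square power3_eq_cube)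
  finally show ?thesis
    unfolding trace_sum_rank_one_2 trace_sum_rank_one_3 inner_glick_form_coef .
qed

text \<open>The determinant of the transformation cancels in every coefficient, so transported lifts
  have the same coefficients as the original ones. A formula \<open>F\<close> in the coefficients
  that is valid for all lifts therefore gives equal values on both polygons.\<close>

lemma projective_invariant_coef:
  assumes "\<And>P p. \<lbrakk>glick_domain P; lifts n P p\<rbrakk> \<Longrightarrow> f P = F (coef p)"
  shows "projective_invariant n f"
  unfolding projective_invariant_def
proof (intro allI impI, elim conjE)
  fix P \<psi>
  assume P: "ngon n P" "glick_domain P" and \<psi>: "projective_transformation \<psi>"
  obtain A :: "real^3^3" where A: "invertible A" "\<And>q. line_of (\<psi> q) = (\<lambda>v. A *v v) ` line_of q"
    using \<psi> unfolding projective_transformation_def by blast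
  obtain p where p: "lifts n P p"
    using lifts_exist[OF P(1)] .
  show "f (\<psi> \<circ> P) = f P"
    using assms[OF glick_domain_projective[OF \<psi> P(2)] lifts_projective[OF p A]]
      assms[OF P(2) p] coef_matrix_mult[OF A(1)] by simp
qed

section \<open>The spectrum\<close>

lemma complexify_mult: "complexify (A ** B) = complexify A ** complexify B"
  by (simp add: complexify_def matrix_matrix_mult_def vec_eq_iff)

lemma trace_complexify: "trace (complexify A) = of_real (trace A)"
  by (simp add: complexify_def trace_def)

lemma det_complexify: "det (complexify A) = of_real (det A)"
  by (simp add: complexify_def det_def)

lemma det_glick:
  assumes "glick_domain P" "lifts n P p"
  shows "det (mat t - matrix (glick n P)) =
    (t - 2 * real n / 3) ^ 3 - S_inv n P * (t - 2 * real n / 3) - R_inv n P"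
proof -
  have "mat t - matrix (glick n P) = mat (t - 2 * real n / 3) - glick_hat n P"
    by (simp add: glick_hat_def mat_def vec_eq_iff)
  then show ?thesis
    by (simp add: charpoly_traceless_3[OF trace_glick_hat[OF assms]] S_inv_def R_inv_def)
qed

text \<open>Complex eigenvalues and their multiplicities call for the identity at complex arguments;
  trace and determinant commute with the embedding of the reals, so the coefficients remain the
  same.\<close>

lemma det_complexify_glick:
  assumes "glick_domain P" "lifts n P p"
  shows "det (mat z - complexify (matrix (glick n P))) =
    (z - of_real (2 * real n / 3)) ^ 3 - of_real (S_inv n P) * (z - of_real (2 * real n / 3))
      - of_real (R_inv n P)"
proof -
  have *: "mat z - complexify (matrix (glick n P))
      = mat (z - of_real (2 * real n / 3)) - complexify (glick_hat n P)"
    by (simp add: glick_hat_def complexify_def mat_def vec_eq_iff)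
  have "trace (complexify (glick_hat n P)) = 0"
    by (simp add: trace_complexify trace_glick_hat[OF assms])
  from charpoly_traceless_3[OF this] show ?thesis
    unfolding * by (simp add: S_inv_def R_inv_def det_complexify trace_complexify
        flip: complexify_mult)
qed

lemma spectrum_eq_det: "spectrum A = {z. det (mat z - complexify A) = 0}"
proof -
  have "(\<exists>v. v \<noteq> 0 \<and> complexify A *v v = z *s v) \<longleftrightarrow> det (mat z - complexify A) = 0" for z
  proof -
    have "mat z *v v = z *s v" for v :: "complex^'a"
      by (simp add: vec_eq_iff matrix_vector_mult_def mat_def if_distrib if_distribR
          cong: if_cong)
    then have "(mat z - complexify A) *v v = 0 \<longleftrightarrow> complexify A *v v = z *s v" for v
      by (auto simp: matrix_vector_mult_diff_rdistrib)
    then show ?thesis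
      using matrix_left_invertible_ker[of "mat z - complexify A"]
        invertible_det_nz[of "mat z - complexify A"]
        invertible_left_inverse[of "mat z - complexify A"] by metis
  qed
  then show ?thesis
    by (simp add: spectrum_def)
qed

text \<open>A complex polynomial is determined by its values. Equality as polynomials is what
  algebraic multiplicities require, since the spectrum is only a set.\<close>

lemma charpoly_complexify_eqI:
  assumes "\<And>z. det (mat z - complexify A) = det (mat z - complexify B)"
  shows "charpoly (complexify A) = charpoly (complexify B)"
  using assms by (simp add: poly_charpoly fun_eq_iff flip: poly_eq_poly_eq_iff)

theorem lemma3p3:
  fixes n :: nat and P :: "int \<Rightarrow> rp2" and p :: "int \<Rightarrow> real^3"
  assumes "ngon n P" and "glick_domain P" and "lifts n P p"
  shows "(projective_invariant n (S_inv n)) \<and>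
     (projective_invariant n (R_inv n)) \<and>
     (\<forall>t::real. poly (charpoly (matrix (glick n P))) t =
           (t - 2 * real n / 3) ^ 3 - S_inv n P * (t - 2 * real n / 3) - R_inv n P) \<and>
     (S_inv n P =
           1/2 * ((\<Sum>i = 1..int n. \<Sum>j = 1..int n. coef p i j * coef p j i) - real n ^ 2 / 3)) \<and>
     (R_inv n P = - 2 * real n ^ 3 / 27
           + real n / 3 * (\<Sum>i = 1..int n. \<Sum>j = 1..int n. coef p i j * coef p j i)
           - 1/3 * (\<Sum>i = 1..int n. \<Sum>j = 1..int n. \<Sum>k = 1..int n.
                      coef p i j * coef p j k * coef p k i)) \<and>
     (\<forall>Q. ngon n Q \<and> glick_domain Q \<and> S_inv n Q = S_inv n P \<and> R_inv n Q = R_inv n P \<longrightarrow>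
           spectrum (matrix (glick n Q)) = spectrum (matrix (glick n P)) \<and>
           (\<forall>z. alg_mult (matrix (glick n Q)) z = alg_mult (matrix (glick n P)) z))"
proof (intro conjI)
  show "projective_invariant n (S_inv n)"
    by (rule projective_invariant_coef) (rule S_inv_coef)
  show "projective_invariant n (R_inv n)"
    by (rule projective_invariant_coef) (rule R_inv_coef)
  show "\<forall>t. poly (charpoly (matrix (glick n P))) t =
      (t - 2 * real n / 3) ^ 3 - S_inv n P * (t - 2 * real n / 3) - R_inv n P"
    unfolding poly_charpoly using det_glick[OF assms(2,3)] by blast
  show "\<forall>Q. ngon n Q \<and> glick_domain Q \<and> S_inv n Q = S_inv n P \<and> R_inv n Q = R_inv n P \<longrightarrow>
      spectrum (matrix (glick n Q)) = spectrum (matrix (glick n P)) \<and>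
      (\<forall>z. alg_mult (matrix (glick n Q)) z = alg_mult (matrix (glick n P)) z)"
  proof (intro allI impI, elim conjE)
    fix Q
    assume Q: "ngon n Q" "glick_domain Q"
      and eq: "S_inv n Q = S_inv n P" "R_inv n Q = R_inv n P"
    obtain q where q: "lifts n Q q"
      using lifts_exist[OF Q(1)] .
    \<comment> \<open>Both sides are the same cubic in \<open>z\<close>, its coefficients being
      determined by \<open>n\<close> and the two invariants.\<close>
    have det: "det (mat z - complexify (matrix (glick n Q)))
        = det (mat z - complexify (matrix (glick n P)))" for z
      by (simp add: det_complexify_glick[OF Q(2) q] det_complexify_glick[OF assms(2,3)] eq)
    show "spectrum (matrix (glick n Q)) = spectrum (matrix (glick n P)) \<and>
        (\<forall>z. alg_mult (matrix (glick n Q)) z = alg_mult (matrix (glick n P)) z)"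
      using charpoly_complexify_eqI[OF det] by (simp add: spectrum_eq_det det alg_mult_def)
  qed
qed (use S_inv_coef[OF assms(2,3)] R_inv_coef[OF assms(2,3)] in blast)+

end
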